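(* Let $p$ and $r$ be two probability distributions on the same discretized asset grid $\{0,\ldots,m-1\}^d$, let $B$ be the basket map on this grid, and assume that the basket value $B(\boldsymbol{x})$ is supported on $[B_{\min},B_{\max}]$ (under both $p$ and $r$). For $K\in\mathbb{R}$ let $$C_p(K)=\mathbb{E}_{\boldsymbol{x}\sim p}[(B(\boldsymbol{x})-K)^+],\qquad C_r(K)=\mathbb{E}_{\boldsymbol{x}\sim r}[(B(\boldsymbol{x})-K)^+]$$ be the undiscounted basket-call expectations, and let $F_p(t)=\Pr_{\boldsymbol{x}\sim p}[B(\boldsymbol{x})\le t]$ and $F_r(t)=\Pr_{\boldsymbol{x}\sim r}[B(\boldsymbol{x})\le t]$ be the cumulative distribution functions of the basket value. If $K<B_{\max}$, then $$|C_p(K)-C_r(K)|\le\int_K^{B_{\max}}|F_p(t)-F_r(t)|\,dt.$$ If $K\ge B_{\max}$, then $C_p(K)=C_r(K)=0$.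
   Context: There are $d$ assets, each discretized on a local grid of size $m=2^q$; a grid configuration is $\boldsymbol{x}=(x_1,\ldots,x_d)$ with $x_i\in\{0,\ldots,m-1\}$. For each asset $i$, $S_i:\{0,\ldots,m-1\}\to\mathbb{R}$ gives the terminal value $S_i(x_i)$ at local grid point $x_i$, and $w_1,\ldots,w_d$ are real basket weights with $\sum_{i=1}^d w_i=1$. The basket map is $B(\boldsymbol{x})=\sum_{i=1}^d w_i S_i(x_i)$. Here $(y)^+=\max(y,0)$. *)

theory Defs
  imports "HOL-Probability.Probability"
begin

(* Assets are indexed by {1..d}. Configurations are extensional functions, so that a function
   on {1..d} is represented exactly once and the grid is a finite set with m^d elements. *)
definition asset_grid :: "nat \<Rightarrow> nat \<Rightarrow> (nat \<Rightarrow> nat) set" where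
  "asset_grid d m = ({1..d} \<rightarrow>\<^sub>E {0..<m})"

definition basket :: "nat \<Rightarrow> (nat \<Rightarrow> real) \<Rightarrow> (nat \<Rightarrow> nat \<Rightarrow> real) \<Rightarrow> (nat \<Rightarrow> nat) \<Rightarrow> real" where
  "basket d w S x = (\<Sum>i=1..d. w i * S i (x i))"

definition call_expectation :: "'a pmf \<Rightarrow> ('a \<Rightarrow> real) \<Rightarrow> real \<Rightarrow> real" where
  "call_expectation p B K = measure_pmf.expectation p (\<lambda>x. max (B x - K) 0)"

definition value_cdf :: "'a pmf \<Rightarrow> ('a \<Rightarrow> real) \<Rightarrow> real \<Rightarrow> real" where
  "value_cdf p B t = measure_pmf.prob p {x. B x \<le> t}"

end

theory Submission
  imports Defs
begin

text \<open>
  For a value \<open>c \<le> b\<close>, the step function \<open>t \<mapsto> [c \<le> t]\<close> integrates over \<open>[K, b]\<close> to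
  \<open>b - max K c = (b - K) - max (c - K) 0\<close>. Averaging over the basket values shows that the
  integral of the distribution function is \<open>b - K\<close> minus the call expectation, so the difference
  of two call expectations is the integral of the difference of the distribution functions.
\<close>

lemma has_integral_step:
  fixes K b c :: real
  assumes "K \<le> b" "c \<le> b"
  shows "((\<lambda>t. of_bool (c \<le> t)) has_integral (b - K - max (c - K) 0)) {K..b}"
proof -
  have "((\<lambda>t. 1::real) has_integral (b - max K c)) {max K c..b}"
    using assms has_integral_const_real[of "1::real" "max K c" b] by simp
  \<comment> \<open>On \<open>{K..b}\<close> the condition \<open>c \<le> t\<close> amounts to
    \<open>t \<in> {max K c..b}\<close>, so the step function is the constant 1 on this subinterval,
    extended by 0.\<close>
  then have "((\<lambda>t. if t \<in> {max K c..b} then 1::real else 0) has_integral (b - max K c)) {K..b}"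
    by (subst has_integral_restrict) auto
  moreover have "b - max K c = b - K - max (c - K) 0"
    by simp
  ultimately show ?thesis
    by (auto elim!: has_integral_eq[rotated])
qed

text \<open>Finite support turns both the distribution function and the call expectation into finite
  sums with the same weights \<open>pmf p x\<close>, so linearity of the integral reduces the claim
  to single steps.\<close>

lemma value_cdf_has_integral:
  fixes K b :: real
  assumes fin: "finite (set_pmf p)" and "K \<le> b" and le: "\<forall>x\<in>set_pmf p. B x \<le> b"
  shows "(value_cdf p B has_integral (b - K - call_expectation p B K)) {K..b}"
proof -
  have cdf: "value_cdf p B t = (\<Sum>x\<in>set_pmf p. pmf p x * of_bool (B x \<le> t))" for t
  proof -
    have "value_cdf p B t = measure_pmf.expectation p (indicator {x. B x \<le> t})"
      by (simp add: value_cdf_def)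
    also have "\<dots> = (\<Sum>x\<in>set_pmf p. pmf p x * indicator {x. B x \<le> t} x)"
      using fin by (subst integral_measure_pmf[of "set_pmf p"]) auto
    finally show ?thesis
      by (simp add: indicator_def of_bool_def)
  qed
  have call: "call_expectation p B K = (\<Sum>x\<in>set_pmf p. pmf p x * max (B x - K) 0)"
    unfolding call_expectation_def
    using fin by (subst integral_measure_pmf[of "set_pmf p"]) auto
  have "((\<lambda>t. \<Sum>x\<in>set_pmf p. pmf p x * of_bool (B x \<le> t)) has_integral
      (\<Sum>x\<in>set_pmf p. pmf p x * (b - K - max (B x - K) 0))) {K..b}"
    using assms by (intro has_integral_sum has_integral_mult_right has_integral_step) auto
  \<comment> \<open>The weights sum to 1, so the constant \<open>b - K\<close> survives averaging
    unchanged.\<close>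
  moreover have "(\<Sum>x\<in>set_pmf p. pmf p x * (b - K - max (B x - K) 0))
      = b - K - call_expectation p B K"
    using sum_pmf_eq_1[OF fin order_refl]
    by (simp add: call right_diff_distrib sum_subtractf flip: sum_distrib_right)
  ultimately show ?thesis
    by (simp add: cdf[abs_def])
qed

lemma value_cdf_absolutely_integrable:
  fixes K b :: real
  assumes "finite (set_pmf p)" "K \<le> b" "\<forall>x\<in>set_pmf p. B x \<le> b"
  shows "value_cdf p B absolutely_integrable_on {K..b}"
  using value_cdf_has_integral[OF assms]
  by (intro nonnegative_absolutely_integrable_1) (auto simp: value_cdf_def integrable_on_def)

lemma call_expectation_diff_le:
  fixes K b :: real
  assumes p: "finite (set_pmf p)" "\<forall>x\<in>set_pmf p. B x \<le> b"
    and r: "finite (set_pmf r)" "\<forall>x\<in>set_pmf r. B x \<le> b"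
    and K: "K \<le> b"
  shows "\<bar>call_expectation p B K - call_expectation r B K\<bar>
    \<le> integral {K..b} (\<lambda>t. \<bar>value_cdf p B t - value_cdf r B t\<bar>)"
proof -
  let ?D = "\<lambda>t. value_cdf p B t - value_cdf r B t"
  \<comment> \<open>The terms \<open>b - K\<close> cancel. Each call expectation enters its integral
    with a minus sign, hence the swapped order of \<open>p\<close> and \<open>r\<close>.\<close>
  have "(?D has_integral (call_expectation r B K - call_expectation p B K)) {K..b}"
    using has_integral_diff[OF value_cdf_has_integral[OF p(1) K p(2)]
        value_cdf_has_integral[OF r(1) K r(2)]] by simp
  then have D: "integral {K..b} ?D = call_expectation r B K - call_expectation p B K"
    by (rule integral_unique)
  \<comment> \<open>The norm bound needs the absolute difference to be integrable as well; for a
    non-integrable function \<open>integral\<close> would be 0 by default.\<close>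
  have "?D absolutely_integrable_on {K..b}"
    using p r K by (intro set_integral_diff(1) value_cdf_absolutely_integrable)
  then have "norm (integral {K..b} ?D) \<le> integral {K..b} (\<lambda>t. norm (?D t))"
    by (intro integral_norm_bound_integral)
      (auto simp: absolutely_integrable_on_def)
  then show ?thesis
    by (simp add: D abs_minus_commute)
qed

lemma call_expectation_eq_0:
  assumes "\<forall>x\<in>set_pmf p. B x \<le> K"
  shows "call_expectation p B K = 0"
  unfolding call_expectation_def
  using assms by (intro integral_eq_zero_AE) (auto simp: AE_measure_pmf_iff)

theorem proposition3:
  fixes d q m :: nat
    and S :: "nat \<Rightarrow> nat \<Rightarrow> real"
    and w :: "nat \<Rightarrow> real"
    and p r :: "(nat \<Rightarrow> nat) pmf"
    and B :: "(nat \<Rightarrow> nat) \<Rightarrow> real"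
    and Bmin Bmax K :: real
  assumes "m = 2 ^ q"
    and "(\<Sum>i=1..d. w i) = 1"
    and "B = basket d w S"
    and "set_pmf p \<subseteq> asset_grid d m"
    and "set_pmf r \<subseteq> asset_grid d m"
    and "\<forall>x\<in>set_pmf p. B x \<in> {Bmin..Bmax}"
    and "\<forall>x\<in>set_pmf r. B x \<in> {Bmin..Bmax}"
  shows "(K < Bmax \<longrightarrow>
            \<bar>call_expectation p B K - call_expectation r B K\<bar>
              \<le> integral {K..Bmax} (\<lambda>t. \<bar>value_cdf p B t - value_cdf r B t\<bar>))
       \<and> (K \<ge> Bmax \<longrightarrow> call_expectation p B K = 0 \<and> call_expectation r B K = 0)"
proof -
  \<comment> \<open>Finiteness of the grid passes to both supports, as the finite-sum representation
    requires.\<close>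
  have "finite (asset_grid d m)"
    by (simp add: asset_grid_def finite_PiE)
  then have "finite (set_pmf p)" "finite (set_pmf r)"
    using assms(4,5) by (auto intro: finite_subset)
  then show ?thesis
    using assms(6,7) call_expectation_diff_le[of p B Bmax r K]
    by (auto intro!: call_expectation_eq_0 intro: order_trans)
qed

end
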